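(* Let $d,n\ge 1$ be integers, let $X=(x_1,\dots,x_n)$ with $x_1,\dots,x_n\in\mathbb{R}^d$ pairwise distinct, let $Y=(y_1,\dots,y_n)^{\mathsf T}\in\mathbb{R}^n$, and let $\alpha>d$. Then there exists $\phi^*\in\mathcal{A}_{X,Y}$ satisfying $$\phi^*\in\arg\min_{\phi\in\mathcal{A}_{X,Y}}\big\|\mathcal{F}^{-1}[\phi]\big\|_{H^{\alpha/2}}^2 .$$
   Context: The Fourier transform convention is $\mathcal{F}[g](\xi)=\int_{\mathbb{R}^d}g(x)e^{-2\pi i\,\xi^{\mathsf T}x}\,dx$ and $g(x)=\int_{\mathbb{R}^d}\mathcal{F}[g](\xi)e^{2\pi i\,x^{\mathsf T}\xi}\,d\xi$. Write $\langle\xi\rangle=(1+\|\xi\|^2)^{1/2}$ with $\|\cdot\|$ the Euclidean norm. For $\phi\in L^2(\mathbb{R}^d)$ (complex-valued), set $$\big\|\mathcal{F}^{-1}[\phi]\big\|_{H^{\alpha/2}}=\Big(\int_{\mathbb{R}^d}\langle\xi\rangle^{\alpha}|\phi(\xi)|^2\,d\xi\Big)^{1/2}\in[0,\infty].$$ For $X=(x_1,\dots,x_n)$ and $\phi\in L^1(\mathbb{R}^d)\cap L^2(\mathbb{R}^d)$, set $$\mathcal{P}_X\phi=\Big(\int_{\mathbb{R}^d}\phi(\xi)e^{2\pi i\,\xi\cdot x_1}\,d\xi,\ \dots,\ \int_{\mathbb{R}^d}\phi(\xi)e^{2\pi i\,\xi\cdot x_n}\,d\xi\Big)^{\mathsf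 T}.$$ The admissible class is $\mathcal{A}_{X,Y}=\{\phi\in L^1(\mathbb{R}^d)\cap L^2(\mathbb{R}^d)\mid \mathcal{P}_X\phi=Y\}$, where $Y\in\mathbb{R}^n$ is regarded as an element of $\mathbb{C}^n$. *)

theory Defs
  imports "HOL-Analysis.Analysis"
begin

text \<open>
  The frequency space is \<^typ>\<open>real ^ 'd\<close> with the (complete) Lebesgue measure.  Elements of
  the $L^p$ spaces are represented by functions; functions that agree almost everywhere are not
  identified.
\<close>

definition japanese :: "real ^ 'd \<Rightarrow> real" where
  "japanese \<xi> = sqrt (1 + (norm \<xi>)\<^sup>2)"

definition L1 :: "(real ^ 'd \<Rightarrow> complex) set" where
  "L1 = {\<phi>. integrable lebesgue \<phi>}"

definition L2 :: "(real ^ 'd \<Rightarrow> complex) set" where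
  "L2 = {\<phi> \<in> borel_measurable lebesgue. integrable lebesgue (\<lambda>\<xi>. (cmod (\<phi> \<xi>))\<^sup>2)}"

definition ennsqrt :: "ennreal \<Rightarrow> ennreal" where
  "ennsqrt x = (if x = \<infinity> then \<infinity> else ennreal (sqrt (enn2real x)))"

text \<open>
  The $H^{\alpha/2}$ norm of the inverse Fourier transform of \<open>\<phi>\<close>, given on the frequency side
  and possibly infinite; it is meant for \<open>\<phi> \<in> L2\<close>.
\<close>

definition inv_fourier_sobolev_norm :: "real \<Rightarrow> (real ^ 'd \<Rightarrow> complex) \<Rightarrow> ennreal" where
  "inv_fourier_sobolev_norm \<alpha> \<phi> =
     ennsqrt (\<integral>\<^sup>+ \<xi>. ennreal (japanese \<xi> powr \<alpha> * (cmod (\<phi> \<xi>))\<^sup>2) \<partial>lebesgue)"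

text \<open>
  A family of \<open>n\<close> points of $\mathbb{R}^d$ is indexed by the finite type \<open>'n\<close>.
\<close>

definition sampling :: "(real ^ 'd) ^ 'n \<Rightarrow> (real ^ 'd \<Rightarrow> complex) \<Rightarrow> complex ^ 'n" where
  "sampling X \<phi> =
     (\<chi> j. \<integral>\<xi>. \<phi> \<xi> * exp (2 * complex_of_real pi * \<i> * complex_of_real (\<xi> \<bullet> X $ j)) \<partial>lebesgue)"

definition admissible :: "(real ^ 'd) ^ 'n \<Rightarrow> real ^ 'n \<Rightarrow> (real ^ 'd \<Rightarrow> complex) set" where
  "admissible X Y = {\<phi> \<in> L1 \<inter> L2. sampling X \<phi> = (\<chi> j. complex_of_real (Y $ j))}"

end

theory Submission
  imports Defs
begin

text \<open>
  Integrating an integrable \<open>\<phi>\<close> against the conjugate of the trigonometric polynomial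
  $T_c(\xi) = \sum_j c_j e^{-2\pi i \xi\cdot x_j}$ gives the Hermitian pairing of
  \<open>sampling X \<phi>\<close> with \<open>c\<close>.  The minimiser is sought in the form
  $\langle\xi\rangle^{-\alpha} T_c(\xi)$, where the weight is integrable because \<open>\<alpha> > d\<close>.
  On these functions the sampling operator is injective in \<open>c\<close>: if it vanishes, the pairing
  formula yields $\int \langle\xi\rangle^{-\alpha} |T_c|^2 = 0$, and distinct characters are
  linearly independent.  By dimension it is onto $\mathbb{C}^n$, which gives an admissible
  candidate.  By the pairing formula again, the difference to any other admissible function is
  orthogonal to the candidate in the weighted inner product, so the candidate is minimal.
\<close>

definition wave :: "real ^ 'd \<Rightarrow> real ^ 'd \<Rightarrow> complex" where
  "wave x \<xi> = exp (2 * complex_of_real pi * \<i> * complex_of_real (\<xi> \<bullet> x))"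

text \<open>The waves are conjugated so that \<open>cnj (trig_poly X c \<xi>)\<close> is a
  combination of the kernels \<open>wave (X $ j) \<xi>\<close> that occur in
  \<open>sampling\<close>.\<close>

definition trig_poly :: "(real ^ 'd) ^ 'n \<Rightarrow> complex ^ 'n \<Rightarrow> real ^ 'd \<Rightarrow> complex" where
  "trig_poly X c \<xi> = (\<Sum>j\<in>UNIV. c $ j * cnj (wave (X $ j) \<xi>))"

definition weighted_trig_poly ::
    "real \<Rightarrow> (real ^ 'd) ^ 'n \<Rightarrow> complex ^ 'n \<Rightarrow> real ^ 'd \<Rightarrow> complex" where
  "weighted_trig_poly \<alpha> X c \<xi> = complex_of_real (japanese \<xi> powr (- \<alpha>)) * trig_poly X c \<xi>"

subsection \<open>Integrability of the weight\<close>

lemma japanese_ge_1: "1 \<le> japanese \<xi>"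
  by (simp add: japanese_def)

lemma japanese_pos [simp]: "0 < japanese \<xi>"
  using japanese_ge_1[of \<xi>] by linarith

lemma japanese_neq_0 [simp]: "japanese \<xi> \<noteq> 0"
  using japanese_pos[of \<xi>] by linarith

lemma norm_le_japanese: "norm \<xi> \<le> japanese \<xi>"
  unfolding japanese_def by (rule real_le_rsqrt) simp

lemma continuous_on_japanese [continuous_intros]: "continuous_on A japanese"
  unfolding japanese_def by (intro continuous_intros)

lemma continuous_imp_lebesgue_measurable:
  fixes f :: "real ^ 'd \<Rightarrow> 'b::topological_space"
  assumes "continuous_on UNIV f"
  shows "f \<in> borel_measurable lebesgue"
  using borel_measurable_continuous_onI[OF assms] by (intro measurable_completion) simp

text \<open>A single term suffices: for the least k with \<open>norm \<xi> < 2 ^ k\<close> the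
  bracket is at least 2^(k-1), and all other terms are nonnegative. The right-hand side can be
  integrated from the volumes of balls alone.\<close>

lemma japanese_powr_le_dyadic_sum:
  fixes \<xi> :: "real ^ 'd"
  assumes "\<alpha> > 0"
  shows "ennreal (japanese \<xi> powr (- \<alpha>))
    \<le> (\<Sum>k. ennreal (2 powr (\<alpha> * (1 - real k))) * indicator (ball 0 (2 ^ k)) \<xi>)"
proof -
  have "\<exists>k. norm \<xi> < 2 ^ k"
    by (rule real_arch_pow) simp
  then obtain k where k: "norm \<xi> < 2 ^ k" and least: "\<And>m. m < k \<Longrightarrow> \<not> norm \<xi> < 2 ^ m"
    using exists_least_iff[of "\<lambda>k. norm \<xi> < 2 ^ k"] by blast
  have le: "2 powr (real k - 1) \<le> japanese \<xi>"
  proof (cases k)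
    case 0
    \<comment> \<open>For k = 0 minimality says nothing about the norm, but the bracket is at least
      1, which exceeds 2^(-1).\<close>
    have "2 powr (-1) \<le> (1::real)" by (simp add: powr_minus)
    then show ?thesis using 0 japanese_ge_1[of \<xi>] by simp
  next
    case (Suc m)
    have "2 ^ m \<le> norm \<xi>" using least[of m] Suc by simp
    then show ?thesis using norm_le_japanese[of \<xi>] Suc by (simp add: powr_realpow)
  qed
  have "japanese \<xi> powr (- \<alpha>) \<le> (2 powr (real k - 1)) powr (- \<alpha>)"
    using le assms by (intro powr_mono2') auto
  also have "\<dots> = 2 powr (\<alpha> * (1 - real k))"
    by (simp add: powr_powr algebra_simps)
  finally have "ennreal (japanese \<xi> powr (- \<alpha>))
      \<le> ennreal (2 powr (\<alpha> * (1 - real k))) * indicator (ball 0 (2 ^ k)) \<xi>"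
    using k by (simp add: ennreal_leI)
  also have "\<dots> = (\<Sum>k\<in>{k}. ennreal (2 powr (\<alpha> * (1 - real k))) * indicator (ball 0 (2 ^ k)) \<xi>)"
    by (rule sum.insert[of "{}", simplified sum.empty add_0_right, symmetric]) simp_all
  also have "\<dots> \<le> (\<Sum>k. ennreal (2 powr (\<alpha> * (1 - real k))) * indicator (ball 0 (2 ^ k)) \<xi>)"
    by (rule sum_le_suminf) auto
  finally show ?thesis .
qed

text \<open>After termwise integration of the dyadic bound, the ball of radius 2^k contributes a
  constant times \<open>q ^ k\<close>, so the integral is dominated by a geometric series.\<close>

lemma integrable_japanese_powr:
  assumes "\<alpha> > real CARD('d)"
  shows "integrable lebesgue (\<lambda>\<xi> :: real ^ 'd. japanese \<xi> powr (- \<alpha>))"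
proof (rule integrableI_nonneg)
  show "(\<lambda>\<xi> :: real ^ 'd. japanese \<xi> powr (- \<alpha>)) \<in> borel_measurable lebesgue"
    by (intro continuous_imp_lebesgue_measurable continuous_intros) simp
  define V where "V = unit_ball_vol (real CARD('d))"
  \<comment> \<open>The ratio of the series: each doubling of the radius multiplies the volume by
    2^d and the weight by 2^(-\<alpha>). It is below 1 because \<alpha> > d.\<close>
  define q where "q = 2 powr (real CARD('d) - \<alpha>)"
  have V: "V \<ge> 0" by (simp add: V_def)
  have q: "0 < q" "q < 1" using assms by (simp_all add: q_def powr_less_one)
  have "(\<integral>\<^sup>+ (\<xi> :: real ^ 'd). ennreal (japanese \<xi> powr (- \<alpha>)) \<partial>lebesgue)
      \<le> (\<integral>\<^sup>+ (\<xi> :: real ^ 'd). (\<Sum>k. ennreal (2 powr (\<alpha> * (1 - real k))) * indicator (ball 0 (2 ^ k)) \<xi>) \<partial>lebesgue)"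
    using assms by (intro nn_integral_mono japanese_powr_le_dyadic_sum) simp
  also have "\<dots> = (\<Sum>k. \<integral>\<^sup>+ (\<xi> :: real ^ 'd). ennreal (2 powr (\<alpha> * (1 - real k))) * indicator (ball 0 (2 ^ k)) \<xi> \<partial>lebesgue)"
    by (intro nn_integral_suminf borel_measurable_times_ennreal borel_measurable_const
        borel_measurable_indicator lmeasurable_ball[THEN fmeasurableD])
  also have "\<dots> = (\<Sum>k. ennreal (2 powr \<alpha> * V * q ^ k))"
  proof (rule suminf_cong)
    fix k :: nat
    have "(\<integral>\<^sup>+ (\<xi> :: real ^ 'd). ennreal (2 powr (\<alpha> * (1 - real k))) * indicator (ball 0 (2 ^ k)) \<xi> \<partial>lebesgue)
        = ennreal (2 powr (\<alpha> * (1 - real k))) * emeasure lebesgue (ball (0 :: real ^ 'd) (2 ^ k))"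
      by (rule nn_integral_cmult_indicator) simp
    also have "\<dots> = ennreal (2 powr (\<alpha> * (1 - real k)) * (V * (2 ^ k) ^ CARD('d)))"
      using V by (simp add: emeasure_ball V_def ennreal_mult)
    also have "2 powr (\<alpha> * (1 - real k)) * (V * (2 ^ k) ^ CARD('d)) = 2 powr \<alpha> * V * q ^ k"
    proof -
      have "((2::real) ^ k) ^ CARD('d) = 2 powr real (k * CARD('d))"
        by (subst powr_realpow) (simp_all only: power_mult zero_less_numeral)
      then have vol: "((2::real) ^ k) ^ CARD('d) = 2 powr (real k * real CARD('d))"
        by (simp only: of_nat_mult)
      have q_power: "q ^ k = 2 powr ((real CARD('d) - \<alpha>) * real k)"
        by (simp add: q_def powr_power mult.commute)
      have "\<alpha> * (1 - real k) + real k * real CARD('d) = \<alpha> + (real CARD('d) - \<alpha>) * real k"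
        by (simp add: algebra_simps)
      then have "2 powr (\<alpha> * (1 - real k)) * 2 powr (real k * real CARD('d))
          = 2 powr \<alpha> * 2 powr ((real CARD('d) - \<alpha>) * real k)"
        by (simp only: powr_add[symmetric])
      then show ?thesis
        unfolding vol q_power by (metis mult.assoc mult.commute)
    qed
    finally show "(\<integral>\<^sup>+ (\<xi> :: real ^ 'd). ennreal (2 powr (\<alpha> * (1 - real k))) * indicator (ball 0 (2 ^ k)) \<xi> \<partial>lebesgue)
        = ennreal (2 powr \<alpha> * V * q ^ k)" .
  qed
  also have "\<dots> < \<infinity>"
  proof -
    have "summable (\<lambda>k. 2 powr \<alpha> * V * q ^ k)"
      using q by (intro summable_mult summable_geometric) simp
    then show ?thesis
      using V q by (subst suminf_ennreal2) auto
  qed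
  finally show "(\<integral>\<^sup>+ (\<xi> :: real ^ 'd). ennreal (japanese \<xi> powr (- \<alpha>)) \<partial>lebesgue) < \<infinity>" .
qed auto

subsection \<open>Linear independence of characters\<close>

lemma wave_add: "wave x (\<xi> + \<eta>) = wave x \<xi> * wave x \<eta>"
  by (simp add: wave_def inner_add_left distrib_left exp_add)

lemma norm_wave [simp]: "cmod (wave x \<xi>) = 1"
proof -
  have "wave x \<xi> = exp (\<i> * complex_of_real (2 * pi * (\<xi> \<bullet> x)))"
    by (simp add: wave_def algebra_simps)
  then show ?thesis by simp
qed

lemma continuous_on_wave [continuous_intros]: "continuous_on A (wave x)"
  unfolding wave_def by (intro continuous_intros)

lemma wave_separates:
  assumes "x \<noteq> y"
  shows "\<exists>\<eta>. wave x \<eta> \<noteq> wave y \<eta>"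
proof -
  \<comment> \<open>The vector along x - y is scaled so that the two phases differ by half a turn,
    which makes the two values opposite.\<close>
  define \<eta> where "\<eta> = (1 / (2 * ((x - y) \<bullet> (x - y)))) *\<^sub>R (x - y)"
  have "\<eta> \<bullet> (x - y) = 1 / 2"
    using assms by (simp add: \<eta>_def)
  then have eq: "\<eta> \<bullet> x = \<eta> \<bullet> y + 1 / 2"
    by (simp add: inner_diff_right)
  have "wave x \<eta> = wave y \<eta> * exp (complex_of_real pi * \<i>)"
    unfolding wave_def eq by (simp add: exp_add algebra_simps)
  then have "wave x \<eta> = - wave y \<eta>"
    by simp
  moreover have "wave y \<eta> \<noteq> 0"
    by (simp add: wave_def)
  ultimately show ?thesis
    by (intro exI[of _ \<eta>]) simp
qed

text \<open>
  Artin's argument: subtracting a multiple of the relation from its translate by \<open>\<eta>\<close> eliminates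
  one character.
\<close>

lemma characters_independent:
  fixes e :: "'j \<Rightarrow> 'g::ab_group_add \<Rightarrow> 'f::field"
  assumes "finite S"
    and mult: "\<And>j \<xi> \<eta>. e j (\<xi> + \<eta>) = e j \<xi> * e j \<eta>"
    and nonzero: "\<And>j \<xi>. e j \<xi> \<noteq> 0"
    and separate: "\<And>i j. i \<in> S \<Longrightarrow> j \<in> S \<Longrightarrow> i \<noteq> j \<Longrightarrow> \<exists>\<eta>. e i \<eta> \<noteq> e j \<eta>"
    and "\<And>\<xi>. (\<Sum>j\<in>S. c j * e j \<xi>) = 0"
  shows "\<forall>j\<in>S. c j = 0"
  using assms(1,4,5)
proof (induction S arbitrary: c rule: finite_induct)
  case empty
  then show ?case by simp
next
  case (insert a S)
  have rel: "c a * e a \<xi> + (\<Sum>j\<in>S. c j * e j \<xi>) = 0" for \<xi>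
    using insert.prems(2)[of \<xi>] insert.hyps by simp
  have sum_eq: "(\<Sum>j\<in>S. c j * e j \<xi>) = - (c a * e a \<xi>)" for \<xi>
    using rel[of \<xi>] by (simp add: eq_neg_iff_add_eq_0 add.commute)
  have zero: "c j * (e j \<eta> - e a \<eta>) = 0" if "j \<in> S" for j \<eta>
  proof -
    have "\<forall>j\<in>S. c j * (e j \<eta> - e a \<eta>) = 0"
    proof (rule insert.IH)
      show "\<exists>\<eta>. e i \<eta> \<noteq> e j \<eta>" if "i \<in> S" "j \<in> S" "i \<noteq> j" for i j
        using insert.prems(1) that by blast
      fix \<xi>
      \<comment> \<open>The relation at \<open>\<xi> + \<eta>\<close> minus
        \<open>e a \<eta>\<close> times the relation at \<open>\<xi>\<close>: the two contributions
        of \<open>a\<close> cancel, leaving a relation over \<open>S\<close> alone.\<close>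
      have "(\<Sum>j\<in>S. c j * (e j \<eta> - e a \<eta>) * e j \<xi>)
          = (\<Sum>j\<in>S. c j * e j (\<xi> + \<eta>)) - e a \<eta> * (\<Sum>j\<in>S. c j * e j \<xi>)"
        unfolding sum_distrib_left sum_subtractf[symmetric]
        by (intro sum.cong) (simp_all add: mult algebra_simps)
      also have "\<dots> = - (c a * e a (\<xi> + \<eta>)) - e a \<eta> * (- (c a * e a \<xi>))"
        unfolding sum_eq ..
      also have "\<dots> = 0"
        by (simp add: mult algebra_simps)
      finally show "(\<Sum>j\<in>S. c j * (e j \<eta> - e a \<eta>) * e j \<xi>) = 0" .
    qed
    then show ?thesis using that by blast
  qed
  have S: "c j = 0" if j: "j \<in> S" for j
  proof -
    have "j \<noteq> a" using j insert.hyps by blast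
    then obtain \<eta> where "e j \<eta> \<noteq> e a \<eta>"
      using insert.prems(1)[of j a] j by blast
    then show ?thesis using zero[OF j, of \<eta>] by simp
  qed
  moreover have "c a = 0"
    using rel[of 0] S nonzero[of a 0] by simp
  ultimately show ?case by simp
qed

text \<open>Conjugated waves are again nowhere vanishing characters, and distinct points give
  distinct ones.\<close>

lemma trig_poly_eq_0_imp:
  assumes "\<And>i j. i \<noteq> j \<Longrightarrow> X $ i \<noteq> X $ j"
    and "\<And>\<xi>. trig_poly X c \<xi> = 0"
  shows "c = 0"
proof -
  have "\<forall>j\<in>UNIV. c $ j = 0"
  proof (rule characters_independent[where e = "\<lambda>j \<xi>. cnj (wave (X $ j) \<xi>)"])
    show "\<exists>\<eta>. cnj (wave (X $ i) \<eta>) \<noteq> cnj (wave (X $ j) \<eta>)" if "i \<noteq> j" for i j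
      using wave_separates assms(1)[OF that] by simp
    show "(\<Sum>j\<in>UNIV. c $ j * cnj (wave (X $ j) \<xi>)) = 0" for \<xi>
      using assms(2)[of \<xi>] by (simp add: trig_poly_def)
  qed (simp_all add: wave_add, simp add: wave_def)
  then show ?thesis by (simp add: vec_eq_iff)
qed

subsection \<open>The pairing formula\<close>

lemma continuous_on_trig_poly [continuous_intros]: "continuous_on A (trig_poly X c)"
  unfolding trig_poly_def by (intro continuous_intros)

lemma norm_trig_poly_le: "cmod (trig_poly X c \<xi>) \<le> (\<Sum>j\<in>UNIV. cmod (c $ j))"
  unfolding trig_poly_def by (rule sum_norm_le) (simp add: norm_mult)

lemma integrable_mult_bounded_continuous:
  fixes \<phi> :: "real ^ 'd \<Rightarrow> 'b::{real_normed_algebra, second_countable_topology, banach}"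
  assumes "integrable lebesgue \<phi>" "continuous_on UNIV g" "\<And>\<xi>. norm (g \<xi>) \<le> B"
  shows "integrable lebesgue (\<lambda>\<xi>. \<phi> \<xi> * g \<xi>)"
proof (rule Bochner_Integration.integrable_bound)
  show "integrable lebesgue (\<lambda>\<xi>. B * norm (\<phi> \<xi>))"
    using assms(1) by simp
  show "(\<lambda>\<xi>. \<phi> \<xi> * g \<xi>) \<in> borel_measurable lebesgue"
    using assms(1) continuous_imp_lebesgue_measurable[OF assms(2)] by simp
  have "norm (\<phi> \<xi> * g \<xi>) \<le> norm (B * norm (\<phi> \<xi>))" for \<xi>
  proof -
    have "norm (\<phi> \<xi> * g \<xi>) \<le> norm (\<phi> \<xi>) * norm (g \<xi>)"
      by (rule norm_mult_ineq)
    also have "\<dots> \<le> norm (\<phi> \<xi>) * B"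
      by (intro mult_left_mono assms(3)) simp
    also have "\<dots> \<le> norm (B * norm (\<phi> \<xi>))"
      by (simp add: mult.commute abs_mult mult_right_mono)
    finally show ?thesis .
  qed
  then show "AE \<xi> in lebesgue. norm (\<phi> \<xi> * g \<xi>) \<le> norm (B * norm (\<phi> \<xi>))"
    by simp
qed

lemma integrable_mult_wave:
  assumes "integrable lebesgue \<phi>"
  shows "integrable lebesgue (\<lambda>\<xi>. \<phi> \<xi> * wave x \<xi>)"
  by (rule integrable_mult_bounded_continuous[OF assms, of _ 1]) (simp_all add: continuous_on_wave)

lemma sampling_nth: "sampling X \<phi> $ j = (\<integral>\<xi>. \<phi> \<xi> * wave (X $ j) \<xi> \<partial>lebesgue)"
  by (simp add: sampling_def wave_def)

text \<open>Finite linearity of the integral, once conjugation has turned each term into a sampling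
  kernel. The form \<open>has_bochner_integral\<close> delivers integrability together with the
  value; both are used later.\<close>

lemma has_bochner_integral_trig_poly_pairing:
  assumes "integrable lebesgue \<phi>"
  shows "has_bochner_integral lebesgue (\<lambda>\<xi>. \<phi> \<xi> * cnj (trig_poly X c \<xi>))
    (\<Sum>j\<in>UNIV. cnj (c $ j) * sampling X \<phi> $ j)"
proof -
  have "\<phi> \<xi> * cnj (trig_poly X c \<xi>) = (\<Sum>j\<in>UNIV. cnj (c $ j) * (\<phi> \<xi> * wave (X $ j) \<xi>))" for \<xi>
    by (simp add: trig_poly_def sum_distrib_left algebra_simps)
  moreover have "has_bochner_integral lebesgue
      (\<lambda>\<xi>. \<Sum>j\<in>UNIV. cnj (c $ j) * (\<phi> \<xi> * wave (X $ j) \<xi>)) (\<Sum>j\<in>UNIV. cnj (c $ j) * sampling X \<phi> $ j)"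
    unfolding sampling_nth
    by (intro has_bochner_integral_sum has_bochner_integral_mult_right
        has_bochner_integral_integrable integrable_mult_wave assms)
  ultimately show ?thesis by simp
qed

subsection \<open>Weighted trigonometric polynomials\<close>

text \<open>This cancellation turns the weighted inner product with a candidate into the plain
  pairing with \<open>trig_poly X c\<close>, which sees a function only through its samples.\<close>

lemma japanese_powr_mult_weighted:
  "complex_of_real (japanese \<xi> powr \<alpha>) * weighted_trig_poly \<alpha> X c \<xi> = trig_poly X c \<xi>"
proof -
  have "japanese \<xi> powr \<alpha> * japanese \<xi> powr (- \<alpha>) = 1"
    using japanese_pos[of \<xi>] by (simp add: powr_minus)
  then show ?thesis
    by (simp add: weighted_trig_poly_def flip: mult.assoc of_real_mult)
qed

lemma integrable_weighted_trig_poly: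
  fixes X :: "(real ^ 'd) ^ 'n"
  assumes "\<alpha> > real CARD('d)"
  shows "integrable lebesgue (weighted_trig_poly \<alpha> X c)"
  unfolding weighted_trig_poly_def[abs_def]
  by (rule integrable_mult_bounded_continuous[OF _ continuous_on_trig_poly norm_trig_poly_le])
    (intro integrable_of_real integrable_japanese_powr assms)

text \<open>The candidate is integrable and bounded, since the weight is at most 1; a bounded
  integrable function is square integrable.\<close>

lemma weighted_trig_poly_in_L2:
  fixes X :: "(real ^ 'd) ^ 'n"
  assumes "\<alpha> > real CARD('d)"
  shows "weighted_trig_poly \<alpha> X c \<in> L2"
proof -
  let ?\<phi> = "weighted_trig_poly \<alpha> X c"
  let ?B = "\<Sum>j\<in>UNIV. cmod (c $ j)"
  have int: "integrable lebesgue ?\<phi>"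
    by (rule integrable_weighted_trig_poly[OF assms])
  have cont: "continuous_on UNIV ?\<phi>"
    unfolding weighted_trig_poly_def[abs_def] by (intro continuous_intros) auto
  have le: "cmod (?\<phi> \<xi>) \<le> ?B" for \<xi>
  proof -
    have "japanese \<xi> powr (- \<alpha>) \<le> 1"
      using powr_mono[of "- \<alpha>" 0 "japanese \<xi>"] japanese_ge_1[of \<xi>] assms by simp
    then have "cmod (?\<phi> \<xi>) \<le> 1 * ?B"
      unfolding weighted_trig_poly_def norm_mult
      by (intro mult_mono norm_trig_poly_le) auto
    then show ?thesis by simp
  qed
  have "integrable lebesgue (\<lambda>\<xi>. cmod (?\<phi> \<xi>) * cmod (?\<phi> \<xi>))"
    using le by (intro integrable_mult_bounded_continuous[where B = ?B] integrable_norm int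
        continuous_on_norm cont) simp
  then show ?thesis
    using int by (simp add: L2_def power2_eq_square borel_measurable_integrable)
qed

section \<open>Surjectivity of sampling on the candidates\<close>

lemma sampling_weighted_trig_poly_onto:
  fixes X :: "(real ^ 'd) ^ 'n"
  assumes distinct: "\<And>i j. i \<noteq> j \<Longrightarrow> X $ i \<noteq> X $ j"
    and alpha: "\<alpha> > real CARD('d)"
  shows "surj (\<lambda>c. sampling X (weighted_trig_poly \<alpha> X c))"
proof (rule linear_inj_imp_surj)
  let ?L = "\<lambda>c. sampling X (weighted_trig_poly \<alpha> X c)"
  have int: "integrable lebesgue (\<lambda>\<xi>. weighted_trig_poly \<alpha> X c \<xi> * wave (X $ j) \<xi>)" for c :: "complex ^ 'n" and j
    by (intro integrable_mult_wave integrable_weighted_trig_poly alpha)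
  \<comment> \<open>Real linearity is enough: source and target are the same finite-dimensional real
    space, so injectivity gives surjectivity.\<close>
  show lin: "linear ?L"
  proof (rule linearI)
    fix c c' :: "complex ^ 'n" and r :: real
    have "weighted_trig_poly \<alpha> X (c + c') \<xi> = weighted_trig_poly \<alpha> X c \<xi> + weighted_trig_poly \<alpha> X c' \<xi>" for \<xi>
      by (simp add: weighted_trig_poly_def trig_poly_def sum.distrib algebra_simps)
    then show "?L (c + c') = ?L c + ?L c'"
      by (simp add: vec_eq_iff sampling_nth distrib_right Bochner_Integration.integral_add int)
    have "weighted_trig_poly \<alpha> X (r *\<^sub>R c) \<xi> = r *\<^sub>R weighted_trig_poly \<alpha> X c \<xi>" for \<xi>
      by (simp add: weighted_trig_poly_def trig_poly_def flip: scaleR_sum_right)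
    then show "?L (r *\<^sub>R c) = r *\<^sub>R ?L c"
      by (simp add: vec_eq_iff sampling_nth)
  qed
  have "c = 0" if L: "?L c = 0" for c
  proof (rule trig_poly_eq_0_imp[OF distinct])
    let ?g = "\<lambda>\<xi>. japanese \<xi> powr (- \<alpha>) * (cmod (trig_poly X c \<xi>))\<^sup>2"
    \<comment> \<open>Pairing the candidate with its own polynomial gives the nonnegative integrand
      \<open>?g\<close>, while the pairing formula evaluates the integral to 0 because all samples
      vanish.\<close>
    have "weighted_trig_poly \<alpha> X c \<xi> * cnj (trig_poly X c \<xi>) = complex_of_real (?g \<xi>)" for \<xi>
      by (simp add: weighted_trig_poly_def complex_norm_square mult.assoc del: of_real_power)
    then have "has_bochner_integral lebesgue (\<lambda>\<xi>. complex_of_real (?g \<xi>)) 0"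
      using has_bochner_integral_trig_poly_pairing[OF integrable_weighted_trig_poly[OF alpha], of X c X c] L
      by simp
    then have "integrable lebesgue ?g" "integral\<^sup>L lebesgue ?g = 0"
      unfolding has_bochner_integral_iff complex_of_real_integrable_eq integral_complex_of_real
      by simp_all
    then have "AE \<xi> in lebesgue. ?g \<xi> = 0"
      by (subst (asm) integral_nonneg_eq_0_iff_AE) auto
    then have AE: "AE \<xi> in lebesgue. \<xi> \<notin> {\<xi>. trig_poly X c \<xi> \<noteq> 0}"
      by (rule AE_mp) (auto intro!: AE_I2)
    \<comment> \<open>Continuity upgrades vanishing almost everywhere to vanishing everywhere: a
      negligible open set is empty.\<close>
    have "open {\<xi>. trig_poly X c \<xi> \<noteq> 0}"
      by (intro open_Collect_neq continuous_intros)
    moreover from this have "{\<xi>. trig_poly X c \<xi> \<noteq> 0} \<in> sets lebesgue"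
      by (intro sets_completionI_sets) simp
    then have "negligible {\<xi>. trig_poly X c \<xi> \<noteq> 0}"
      using AE by (simp only: negligible_iff_null_sets AE_iff_null_sets)
    ultimately show "trig_poly X c \<xi> = 0" for \<xi>
      using open_not_negligible by blast
  qed
  then show "inj ?L"
    using linear_injective_0[OF lin] by blast
qed

section \<open>Minimality of the candidate energy\<close>

lemma integrable_weighted_energy:
  fixes X :: "(real ^ 'd) ^ 'n"
  assumes "\<alpha> > real CARD('d)"
  shows "integrable lebesgue (\<lambda>\<xi>. japanese \<xi> powr \<alpha> * (cmod (weighted_trig_poly \<alpha> X c \<xi>))\<^sup>2)"
proof -
  \<comment> \<open>The weight of the energy is absorbed by one of the two factors of the squared
    modulus, so the energy density is an instance of the pairing.\<close>
  have "complex_of_real (japanese \<xi> powr \<alpha> * (cmod (weighted_trig_poly \<alpha> X c \<xi>))\<^sup>2)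
      = weighted_trig_poly \<alpha> X c \<xi> * cnj (trig_poly X c \<xi>)" for \<xi>
    unfolding japanese_powr_mult_weighted[of \<xi> \<alpha>, symmetric] of_real_mult complex_norm_square by simp
  then show ?thesis
    unfolding complex_of_real_integrable_eq[symmetric]
    using has_bochner_integral_trig_poly_pairing[OF integrable_weighted_trig_poly[OF assms, of X c], of X c]
    by (simp only: has_bochner_integral_iff)
qed

text \<open>The square is expanded around the candidate: the cross term integrates to zero because
  the samples agree, and the remaining square is nonnegative. A competitor of infinite energy is
  trivial.\<close>

lemma nn_integral_energy_le:
  fixes X :: "(real ^ 'd) ^ 'n"
  assumes alpha: "\<alpha> > real CARD('d)"
    and \<phi>: "integrable lebesgue \<phi>"
    and same: "sampling X (weighted_trig_poly \<alpha> X c) = sampling X \<phi>"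
  shows "(\<integral>\<^sup>+ \<xi>. ennreal (japanese \<xi> powr \<alpha> * (cmod (weighted_trig_poly \<alpha> X c \<xi>))\<^sup>2) \<partial>lebesgue)
    \<le> (\<integral>\<^sup>+ \<xi>. ennreal (japanese \<xi> powr \<alpha> * (cmod (\<phi> \<xi>))\<^sup>2) \<partial>lebesgue)"
proof (cases "(\<integral>\<^sup>+ \<xi>. ennreal (japanese \<xi> powr \<alpha> * (cmod (\<phi> \<xi>))\<^sup>2) \<partial>lebesgue) < \<infinity>")
  case False
  then show ?thesis by (simp add: less_top[symmetric])
next
  case True
  let ?\<psi> = "weighted_trig_poly \<alpha> X c"
  let ?E = "\<lambda>\<phi> \<xi>. japanese \<xi> powr \<alpha> * (cmod (\<phi> \<xi>))\<^sup>2"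
  let ?h = "\<lambda>\<xi>. (\<phi> \<xi> - ?\<psi> \<xi>) * cnj (trig_poly X c \<xi>)"
  have \<psi>: "integrable lebesgue ?\<psi>"
    by (rule integrable_weighted_trig_poly[OF alpha])
  have "(\<lambda>\<xi> :: real ^ 'd. japanese \<xi> powr \<alpha>) \<in> borel_measurable lebesgue"
    by (intro continuous_imp_lebesgue_measurable continuous_intros) simp
  then have E\<phi>: "integrable lebesgue (?E \<phi>)"
    using \<phi> True by (intro integrableI_nonneg) auto
  have E\<psi>: "integrable lebesgue (?E ?\<psi>)"
    by (rule integrable_weighted_energy[OF alpha])
  \<comment> \<open>Orthogonality: \<open>?h\<close> is the density of the weighted inner product of
    \<open>\<phi> - ?\<psi>\<close> with \<open>?\<psi>\<close>, and the pairing formula gives equal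
    values for \<open>\<phi>\<close> and \<open>?\<psi>\<close>.\<close>
  have h: "has_bochner_integral lebesgue ?h 0"
    using has_bochner_integral_diff[OF has_bochner_integral_trig_poly_pairing[OF \<phi>, of X c]
        has_bochner_integral_trig_poly_pairing[OF \<psi>, of X c]] same
    by (simp add: left_diff_distrib)
  then have Reh: "has_bochner_integral lebesgue (\<lambda>\<xi>. Re (?h \<xi>)) 0"
    using has_bochner_integral_Re by fastforce
  \<comment> \<open>The nonnegative term in \<open>\<phi> - ?\<psi>\<close> is dropped pointwise, so
    its integrability never has to be established.\<close>
  have ineq: "?E ?\<psi> \<xi> + 2 * Re (?h \<xi>) \<le> ?E \<phi> \<xi>" for \<xi>
  proof -
    let ?w = "japanese \<xi> powr \<alpha>"
    have Reh_eq: "Re (?h \<xi>) = ?w * Re ((\<phi> \<xi> - ?\<psi> \<xi>) * cnj (?\<psi> \<xi>))"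
      unfolding japanese_powr_mult_weighted[of \<xi> \<alpha>, symmetric]
      by (simp add: algebra_simps)
    have expand: "(cmod (\<phi> \<xi>))\<^sup>2
        = (cmod (?\<psi> \<xi>))\<^sup>2 + 2 * Re ((\<phi> \<xi> - ?\<psi> \<xi>) * cnj (?\<psi> \<xi>)) + (cmod (\<phi> \<xi> - ?\<psi> \<xi>))\<^sup>2"
      unfolding cmod_power2 by (simp add: power2_eq_square algebra_simps)
    have "?E \<phi> \<xi> = ?E ?\<psi> \<xi> + 2 * Re (?h \<xi>) + ?w * (cmod (\<phi> \<xi> - ?\<psi> \<xi>))\<^sup>2"
      unfolding Reh_eq expand by (simp only: distrib_left ac_simps)
    then show ?thesis by simp
  qed
  have "has_bochner_integral lebesgue (\<lambda>\<xi>. ?E ?\<psi> \<xi> + 2 * Re (?h \<xi>))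
      (integral\<^sup>L lebesgue (?E ?\<psi>) + 2 * 0)"
    by (intro has_bochner_integral_add has_bochner_integral_mult_right
        has_bochner_integral_integrable E\<psi> Reh)
  then have lower: "has_bochner_integral lebesgue (\<lambda>\<xi>. ?E ?\<psi> \<xi> + 2 * Re (?h \<xi>))
      (integral\<^sup>L lebesgue (?E ?\<psi>))"
    by (simp only: mult_zero_right add_0_right)
  have "integral\<^sup>L lebesgue (?E ?\<psi>) \<le> integral\<^sup>L lebesgue (?E \<phi>)"
    using integral_mono[OF has_bochner_integral_iff[THEN iffD1, THEN conjunct1, OF lower] E\<phi> ineq]
    by (simp only: has_bochner_integral_integral_eq[OF lower])
  then show ?thesis
    using E\<psi> E\<phi> by (simp add: nn_integral_eq_integral ennreal_leI)
qed

lemma ennsqrt_mono: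
  assumes "x \<le> y"
  shows "ennsqrt x \<le> ennsqrt y"
  using assms
  by (auto simp: ennsqrt_def top_unique less_top intro!: ennreal_leI enn2real_mono)

theorem theorem2:
  fixes X :: "(real ^ 'd) ^ 'n"
    and Y :: "real ^ 'n"
    and \<alpha> :: real
  assumes distinct: "\<And>i j. i \<noteq> j \<Longrightarrow> X $ i \<noteq> X $ j"
    and alpha: "\<alpha> > real CARD('d)"
  shows "\<exists>\<phi>\<^sub>0 \<in> admissible X Y.
           is_arg_min (\<lambda>\<phi>. (inv_fourier_sobolev_norm \<alpha> \<phi>)\<^sup>2) (\<lambda>\<phi>. \<phi> \<in> admissible X Y) \<phi>\<^sub>0"
proof -
  obtain c where c: "sampling X (weighted_trig_poly \<alpha> X c) = (\<chi> j. complex_of_real (Y $ j))"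
    using surjD[OF sampling_weighted_trig_poly_onto[OF distinct alpha]] by metis
  let ?\<psi> = "weighted_trig_poly \<alpha> X c"
  have \<psi>: "?\<psi> \<in> admissible X Y"
    using c integrable_weighted_trig_poly[OF alpha, of X c] weighted_trig_poly_in_L2[OF alpha, of X c]
    by (simp add: admissible_def L1_def)
  \<comment> \<open>Both \<open>ennsqrt\<close> and squaring are monotone on [0, infinity], so the
    comparison of energies carries over, infinite values included.\<close>
  have "(inv_fourier_sobolev_norm \<alpha> ?\<psi>)\<^sup>2 \<le> (inv_fourier_sobolev_norm \<alpha> \<phi>)\<^sup>2"
    if "\<phi> \<in> admissible X Y" for \<phi>
    unfolding inv_fourier_sobolev_norm_def
    using that c alpha
    by (intro power_mono ennsqrt_mono nn_integral_energy_le) (auto simp: admissible_def L1_def)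
  then show ?thesis
    using \<psi> by (intro bexI[of _ ?\<psi>]) (auto simp: is_arg_min_linorder)
qed

end
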